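(* Let $f=(f_1,\dots,f_m)^\top:\mathbb{R}^n\to\mathbb{R}^m$ with each $f_i$ twice continuously differentiable, and let $x_0\in\mathbb{R}^n$. Let $\mathcal{L}_{f(x_0)}=\{x\in\mathbb{R}^n : f_i(x)\le f_i(x_0)\ \text{for all } i\in[m]\}$. Let $\{x_k\}$ be an (infinite) sequence generated from $x_0$ by the BB-DQN algorithm (described in the context), with matrices $B_k$, and let $x^*$ be the limit point of the sequence. Suppose that: (i) there are constants $0<a\le b$ such that $aI_n\preceq B_k\preceq bI_n$ for all $k$; (ii) there are constants $U,V$ with $0<U\le1\le V$ such that $$U\|z\|^2\le z^\top\nabla^2f_i(x)z\le V\|z\|^2\qquad\text{for all } x\in\mathcal{L}_{f(x_0)},\ z\in\mathbb{R}^n,\ i\in[m].$$ Then $\{x_k\}$ converges R-linearly to $x^*$.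
   Context: Notation: $[m]=\{1,\dots,m\}$; $\Delta_m=\{\lambda\in\mathbb{R}^m:\lambda_i\ge0,\ \sum_i\lambda_i=1\}$; $\|\cdot\|$ is the Euclidean norm; $A\preceq B$ means $B-A$ is positive semidefinite; $\|v\|_M=\sqrt{v^\top Mv}$ for $M$ symmetric positive definite. For $x,d\in\mathbb{R}^n$, $\mathcal{D}(x,d)=\max_{i\in[m]}\nabla f_i(x)^\top d$. A sequence $\{x_k\}$ converges R-linearly to $x^*$ if there are $K\ge0$ and $q\in(0,1)$ with $\|x_k-x^*\|\le Kq^k$ for all $k$. A limit point of a sequence is the limit of some subsequence. BB-DQN algorithm. Parameters: $c_0\in(0,1]$, $c_1,c_2,\mu\in(0,\infty)$, $0<\sigma_1<\sigma_2<1$, tolerance $\varepsilon\ge0$, $x_0\in\mathbb{R}^n$, symmetric positive definite $B_0\in\mathbb{R}^{n\times n}$, and a vector $\alpha^{-1}=(\alpha_1^{-1},\dots,\alpha_n^{-1})^\top$ with positive entries (superscripts on $\alpha_j$ are iteration indices, not powers). For $k=0,1,2,\dots$: 1. Let $\lambda^k\in\Delta_m$ be a minimizer of $\frac12\big\|\sum_{i}\lambda_i\nabla f_i(x_k)\big\|^2_{B_k^{-1}}$ over $\lambda\in\Delta_m$, and set $d_k=-B_k^{-1}\sum_{i}\lambda_i^k\nabla f_i(x_k)$ (equivalently, $d_k$ is the unique minimizer of $\max_{i}\nabla f_i(x_k)^\top d+\frac12 d^\top B_kd$). If $\|d_k\|<\varepsilon$ or $d_k=0$, stop. 2. Set $\omega_k=\min\{c_0,\,c_1\|d_k\|^{c_2}\}$.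 3. Choose a step size $t_k>0$ such that $f_i(x_k+t_kd_k)\le f_i(x_k)+\sigma_1t_k\mathcal{D}(x_k,d_k)$ for all $i\in[m]$, and $\mathcal{D}(x_k+t_kd_k,d_k)\ge\sigma_2\mathcal{D}(x_k,d_k)$. 4. Set $x_{k+1}=x_k+t_kd_k$, $s_k=t_kd_k$, $y_k=\sum_{i}\lambda_i^k(\nabla f_i(x_{k+1})-\nabla f_i(x_k))$. 5. If $s_k^\top y_k>0$ and $\big[\frac{y_k^\top s_k}{\|s_k\|^2},\frac{\|y_k\|^2}{y_k^\top s_k}\big]\cap[\omega_k,\omega_k^{-1}]\ne\varnothing$, set $\alpha_k^-=\max\{\frac{y_k^\top s_k}{\|s_k\|^2},\omega_k\}$ and $\alpha_k^+=\min\{\frac{\|y_k\|^2}{y_k^\top s_k},\omega_k^{-1}\}$; otherwise set $\alpha_k^-=\omega_k$, $\alpha_k^+=\omega_k^{-1}$. 6. For $j=1,\dots,n$, let $r_j=\frac{s_j^ky_j^k+\mu\alpha_j^{k-1}}{(s_j^k)^2+\mu}$, where $s_j^k,y_j^k$ are the $j$-th entries of $s_k,y_k$; set $\alpha_j^k=\alpha_k^-$ if $r_j<\alpha_k^-$, $\alpha_j^k=\alpha_k^+$ if $r_j>\alpha_k^+$, and $\alpha_j^k=r_j$ otherwise. The matrix used in the next iteration is $B_{k+1}=\mathrm{Diag}(\alpha_1^k,\dots,\alpha_n^k)$. *)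

theory Defs
  imports "HOL-Analysis.Analysis"
begin

definition grad :: "(real^'n \<Rightarrow> real) \<Rightarrow> real^'n \<Rightarrow> real^'n" where
  "grad \<phi> x = (THE g. GDERIV \<phi> x :> g)"

definition hessian :: "(real^'n \<Rightarrow> real) \<Rightarrow> real^'n \<Rightarrow> real^'n^'n" where
  "hessian \<phi> x = jacobian (grad \<phi>) (at x)"

(* The differentiability clauses come first so that grad and hessian, which are
   total functions in HOL, denote the actual derivatives everywhere. *)
definition twice_continuously_differentiable :: "(real^'n \<Rightarrow> real) \<Rightarrow> bool" where
  "twice_continuously_differentiable \<phi> \<longleftrightarrow>
     (\<forall>x. \<phi> differentiable (at x)) \<and>
     (\<forall>x. grad \<phi> differentiable (at x)) \<and>
     continuous_on UNIV (hessian \<phi>)"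

definition pos_def :: "real^'n^'n \<Rightarrow> bool" where
  "pos_def M \<longleftrightarrow> transpose M = M \<and> (\<forall>z. z \<noteq> 0 \<longrightarrow> 0 < z \<bullet> (M *v z))"

definition pos_semidef :: "real^'n^'n \<Rightarrow> bool" where
  "pos_semidef M \<longleftrightarrow> transpose M = M \<and> (\<forall>z. 0 \<le> z \<bullet> (M *v z))"

definition loewner_le :: "real^'n^'n \<Rightarrow> real^'n^'n \<Rightarrow> bool" (infix \<open>\<preceq>\<close> 50) where
  "A \<preceq> B \<longleftrightarrow> pos_semidef (B - A)"

definition mat_norm :: "real^'n^'n \<Rightarrow> real^'n \<Rightarrow> real" where
  "mat_norm M v = sqrt (v \<bullet> (M *v v))"

definition Diag :: "real^'n \<Rightarrow> real^'n^'n" where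
  "Diag v = (\<chi> i j. if i = j then v $ i else 0)"

definition unit_simplex :: "(real^'m) set" where
  "unit_simplex = {l. (\<forall>i. 0 \<le> l $ i) \<and> (\<Sum>i\<in>UNIV. l $ i) = 1}"

definition level_set :: "('m \<Rightarrow> real^'n \<Rightarrow> real) \<Rightarrow> real^'n \<Rightarrow> (real^'n) set" where
  "level_set f x0 = {x. \<forall>i. f i x \<le> f i x0}"

definition limit_point_of :: "real^'n \<Rightarrow> (nat \<Rightarrow> real^'n) \<Rightarrow> bool" where
  "limit_point_of xs x \<longleftrightarrow> (\<exists>r. strict_mono r \<and> (x \<circ> r) \<longlonglongrightarrow> xs)"

definition R_linearly_converges :: "(nat \<Rightarrow> real^'n) \<Rightarrow> real^'n \<Rightarrow> bool" where
  "R_linearly_converges x xs \<longleftrightarrow>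
     (\<exists>K q. 0 \<le> K \<and> 0 < q \<and> q < 1 \<and> (\<forall>k. norm (x k - xs) \<le> K * q ^ k))"

definition maxdir :: "('m::finite \<Rightarrow> real^'n \<Rightarrow> real) \<Rightarrow> real^'n \<Rightarrow> real^'n \<Rightarrow> real" where
  "maxdir f x d = (MAX i. grad (f i) x \<bullet> d)"

definition comb_grad :: "('m::finite \<Rightarrow> real^'n \<Rightarrow> real) \<Rightarrow> real^'m \<Rightarrow> real^'n \<Rightarrow> real^'n" where
  "comb_grad f l x = (\<Sum>i\<in>UNIV. l $ i *\<^sub>R grad (f i) x)"

definition bb_omega :: "real \<Rightarrow> real \<Rightarrow> real \<Rightarrow> real^'n \<Rightarrow> real" where
  "bb_omega c0 c1 c2 d = min c0 (c1 * norm d powr c2)"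

definition bb_safeguarded :: "real \<Rightarrow> real^'n \<Rightarrow> real^'n \<Rightarrow> bool" where
  "bb_safeguarded w s y \<longleftrightarrow>
     0 < s \<bullet> y \<and>
     {(y \<bullet> s) / (norm s)\<^sup>2 .. (norm y)\<^sup>2 / (y \<bullet> s)} \<inter> {w .. inverse w} \<noteq> {}"

definition bb_lower :: "real \<Rightarrow> real^'n \<Rightarrow> real^'n \<Rightarrow> real" where
  "bb_lower w s y =
     (if bb_safeguarded w s y then max ((y \<bullet> s) / (norm s)\<^sup>2) w else w)"

definition bb_upper :: "real \<Rightarrow> real^'n \<Rightarrow> real^'n \<Rightarrow> real" where
  "bb_upper w s y =
     (if bb_safeguarded w s y then min ((norm y)\<^sup>2 / (y \<bullet> s)) (inverse w) else inverse w)"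

definition clamp_to :: "real \<Rightarrow> real \<Rightarrow> real \<Rightarrow> real" where
  "clamp_to lo hi r = (if r < lo then lo else if r > hi then hi else r)"

definition bb_alpha_update ::
    "real \<Rightarrow> real \<Rightarrow> real^'n \<Rightarrow> real^'n \<Rightarrow> real^'n \<Rightarrow> real^'n" where
  "bb_alpha_update \<mu> w s y \<alpha> =
     (\<chi> j. clamp_to (bb_lower w s y) (bb_upper w s y)
            ((s $ j * y $ j + \<mu> * \<alpha> $ j) / ((s $ j)\<^sup>2 + \<mu>)))"

(* An infinite run, i.e. the stopping test fails at every iteration.
   The index of the diagonal entries is shifted by one: the vector alpha^(k-1) of
   the algorithm is \<alpha> k here, so that \<alpha> 0 = \<alpha>init stands for alpha^(-1).
   The choices of the multipliers and of the step sizes are not deterministic, hence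
   the existential quantifier over lam and t. *)
definition bb_dqn_run ::
    "('m::finite \<Rightarrow> real^'n \<Rightarrow> real) \<Rightarrow> real \<Rightarrow> real \<Rightarrow> real \<Rightarrow> real \<Rightarrow> real \<Rightarrow> real \<Rightarrow> real \<Rightarrow>
     real^'n \<Rightarrow> real^'n^'n \<Rightarrow> real^'n \<Rightarrow> (nat \<Rightarrow> real^'n) \<Rightarrow> (nat \<Rightarrow> real^'n^'n) \<Rightarrow> bool" where
  "bb_dqn_run f c0 c1 c2 \<mu> \<sigma>1 \<sigma>2 \<epsilon> x0 B0 \<alpha>init x B \<longleftrightarrow>
     (\<exists>(lam :: nat \<Rightarrow> real^'m) (d :: nat \<Rightarrow> real^'n) (t :: nat \<Rightarrow> real)
       (s :: nat \<Rightarrow> real^'n) (y :: nat \<Rightarrow> real^'n) (\<alpha> :: nat \<Rightarrow> real^'n).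
        x 0 = x0 \<and> B 0 = B0 \<and> \<alpha> 0 = \<alpha>init \<and>
        (\<forall>k.
          is_arg_min (\<lambda>l. 1/2 * (mat_norm (matrix_inv (B k)) (comb_grad f l (x k)))\<^sup>2)
                     (\<lambda>l. l \<in> unit_simplex) (lam k) \<and>
          d k = - (matrix_inv (B k) *v comb_grad f (lam k) (x k)) \<and>
          \<not> (norm (d k) < \<epsilon> \<or> d k = 0) \<and>
          0 < t k \<and>
          (\<forall>i. f i (x k + t k *\<^sub>R d k) \<le> f i (x k) + \<sigma>1 * t k * maxdir f (x k) (d k)) \<and>
          maxdir f (x k + t k *\<^sub>R d k) (d k) \<ge> \<sigma>2 * maxdir f (x k) (d k) \<and>
          x (Suc k) = x k + t k *\<^sub>R d k \<and>
          s k = t k *\<^sub>R d k \<and>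
          y k = (\<Sum>i\<in>UNIV. lam k $ i *\<^sub>R (grad (f i) (x (Suc k)) - grad (f i) (x k))) \<and>
          \<alpha> (Suc k) = bb_alpha_update \<mu> (bb_omega c0 c1 c2 (d k)) (s k) (y k) (\<alpha> k) \<and>
          B (Suc k) = Diag (\<alpha> (Suc k))))"

end

theory Submission
  imports Defs
begin

text \<open>
  The potential behind the proof is the smallest objective gap
  \<open>m\<^sub>k = min\<^sub>i (f\<^sub>i (x\<^sub>k) - f\<^sub>i (xs))\<close>. Every objective decreases along the run, and along a
  subsequence its values tend to those at \<open>xs\<close>; hence \<open>f\<^sub>i (xs) \<le> f\<^sub>i (x\<^sub>k)\<close> for all \<open>i\<close> and \<open>k\<close>,
  and \<open>m\<^sub>k\<close> is nonnegative and decreases to 0.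

  The level set may be disconnected, and segments between iterates may leave it, so the Hessian
  bounds cannot be used globally. However, the decrease is strict, hence
  \<open>f\<^sub>i (xs) < f\<^sub>i (x\<^sub>0)\<close> for all \<open>i\<close>, and a whole ball around \<open>xs\<close> lies in the level set. For iterates
  in this ball the following estimates hold.

  (a) Gap bound: by strong convexity along the segment to \<open>xs\<close>, weighted with the multipliers that
  define \<open>d\<^sub>k\<close>, the gap \<open>m\<^sub>k\<close> is at most a multiple of \<open>\<parallel>d\<^sub>k\<parallel>\<^sup>2\<close>
  (\<open>min_gap_le_direction\<close>); the minimum is dominated by every convex combination, so it does not
  matter that the weights vary with \<open>k\<close>.

  (b) Armijo decrease: \<open>m\<^sub>k - m\<^sub>k\<^sub>+\<^sub>1\<close> is at least a multiple of \<open>t\<^sub>k \<parallel>d\<^sub>k\<parallel>\<^sup>2\<close>, because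
  optimality of the multipliers bounds every directional derivative along \<open>d\<^sub>k\<close> by
  \<open>- d\<^sub>k \<bullet> B\<^sub>k d\<^sub>k\<close> (\<open>maxdir_le_neg_quadratic_form\<close>).

  (c) Curvature: if \<open>x\<^sub>k\<^sub>+\<^sub>1\<close> is in the ball too, the upper Hessian bound keeps \<open>t\<^sub>k\<close> away from 0.

  From (a) and (b) the step length is at most \<open>\<kappa> (sqrt m\<^sub>k - sqrt m\<^sub>k\<^sub>+\<^sub>1)\<close>, which telescopes: an
  iterate that is close to \<open>xs\<close> and has a small gap traps all later ones, and
  \<open>\<parallel>x\<^sub>k - xs\<parallel> \<le> \<kappa> sqrt m\<^sub>k\<close> from then on (\<open>trapped_by_potential\<close>). In particular a large
  \<open>t\<^sub>k\<close> cannot throw the run out of the ball, since a long step costs more decrease than the gap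
  provides. Once the run is trapped, (a), (b) and (c) give \<open>m\<^sub>k\<^sub>+\<^sub>1 \<le> q m\<^sub>k\<close> with \<open>q < 1\<close>, and the
  distance to \<open>xs\<close> inherits the rate \<open>sqrt q\<close>.
\<close>

section \<open>Second-order estimates along segments\<close>

lemma has_derivative_grad:
  assumes "\<phi> differentiable (at p)"
  shows "(\<phi> has_derivative (\<lambda>h. h \<bullet> grad \<phi> p)) (at p)"
proof -
  obtain D where D: "(\<phi> has_derivative D) (at p)"
    using assms by (auto simp: differentiable_def)
  have D_eq: "D h = h \<bullet> (adjoint D 1)" for h
    using adjoint_works[OF has_derivative_linear[OF D], of h 1] by simp
  then have G: "GDERIV \<phi> p :> adjoint D 1"
    using D unfolding gderiv_def by (metis (no_types, lifting) ext)
  have unique: "g = adjoint D 1" if "GDERIV \<phi> p :> g" for g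
  proof -
    have "(\<lambda>h. h \<bullet> g) = (\<lambda>h. h \<bullet> adjoint D 1)"
      using that G unfolding gderiv_def by (rule has_derivative_unique)
    then show ?thesis
      by (metis vector_eq_ldot)
  qed
  have "grad \<phi> p = adjoint D 1"
    unfolding grad_def using G unique by (rule the_equality)
  with G show ?thesis
    by (simp add: gderiv_def)
qed

lemma line_has_derivative: "((\<lambda>s. p + s *\<^sub>R v) has_derivative (\<lambda>h. h *\<^sub>R v)) (at t)"
  by (auto intro!: derivative_eq_intros)

lemma DERIV_along_line:
  assumes "twice_continuously_differentiable \<phi>"
  shows "((\<lambda>t. \<phi> (p + t *\<^sub>R v)) has_real_derivative (v \<bullet> grad \<phi> (p + t *\<^sub>R v))) (at t)"
proof -
  have "(\<phi> has_derivative (\<lambda>h. h \<bullet> grad \<phi> (p + t *\<^sub>R v))) (at (p + t *\<^sub>R v))"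
    using assms by (intro has_derivative_grad) (simp add: twice_continuously_differentiable_def)
  from has_derivative_compose[OF line_has_derivative this] show ?thesis
    by (simp add: has_field_derivative_def mult_commute_abs)
qed

lemma DERIV_slope_along_line:
  assumes "twice_continuously_differentiable \<phi>"
  shows "((\<lambda>t. v \<bullet> grad \<phi> (p + t *\<^sub>R v)) has_real_derivative
            (v \<bullet> (hessian \<phi> (p + t *\<^sub>R v) *v v))) (at t)"
proof -
  have "(grad \<phi> has_derivative (\<lambda>h. hessian \<phi> (p + t *\<^sub>R v) *v h)) (at (p + t *\<^sub>R v))"
    using assms by (simp add: twice_continuously_differentiable_def hessian_def flip: jacobian_works)
  from has_derivative_inner_right[OF has_derivative_compose[OF line_has_derivative this], of v]
  show ?thesis
    by (simp add: has_field_derivative_def matrix_vector_mult_scaleR mult_commute_abs)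
qed

lemma line_in_convex:
  assumes "convex S" "p \<in> S" "p + v \<in> S" "0 \<le> t" "t \<le> 1"
  shows "p + t *\<^sub>R v \<in> S"
  using convexD_alt[OF assms(1-5)] by (simp add: algebra_simps)

lemma strongly_convex_lower_bound:
  assumes C2: "twice_continuously_differentiable \<phi>"
    and S: "convex S" "p \<in> S" "q \<in> S"
    and hess: "\<And>r z. r \<in> S \<Longrightarrow> U * (norm z)\<^sup>2 \<le> z \<bullet> (hessian \<phi> r *v z)"
  shows "\<phi> p + (q - p) \<bullet> grad \<phi> p + U / 2 * (norm (q - p))\<^sup>2 \<le> \<phi> q"
proof -
  define v where "v = q - p"
  define D :: "nat \<Rightarrow> real \<Rightarrow> real" where
    "D n t = (if n = 0 then \<phi> (p + t *\<^sub>R v) else if n = 1 then v \<bullet> grad \<phi> (p + t *\<^sub>R v)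
              else v \<bullet> (hessian \<phi> (p + t *\<^sub>R v) *v v))" for n t
  have "\<forall>n t. n < 2 \<and> 0 \<le> t \<and> t \<le> 1 \<longrightarrow> DERIV (D n) t :> D (Suc n) t"
  proof (intro allI impI)
    fix n :: nat and t :: real
    assume "n < 2 \<and> 0 \<le> t \<and> t \<le> 1"
    then have "n = 0 \<or> n = 1" by auto
    then show "DERIV (D n) t :> D (Suc n) t"
      unfolding D_def using DERIV_along_line[OF C2] DERIV_slope_along_line[OF C2] by auto
  qed
  from Taylor_up[of 2 D "D 0" 0 1 0, OF _ refl this] obtain t where t: "0 < t" "t < 1"
    and eq: "D 0 1 = D 0 0 + D 1 0 + D 2 t / 2"
    by (auto simp: numeral_2_eq_2)
  have "p + t *\<^sub>R v \<in> S"
    using S t by (intro line_in_convex) (auto simp: v_def)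
  from hess[OF this, of v] eq show ?thesis
    by (simp add: D_def v_def)
qed

lemma slope_upper_bound:
  assumes C2: "twice_continuously_differentiable \<phi>"
    and S: "convex S" "p \<in> S" "p + t *\<^sub>R d \<in> S" and t: "0 < t"
    and hess: "\<And>r z. r \<in> S \<Longrightarrow> z \<bullet> (hessian \<phi> r *v z) \<le> V * (norm z)\<^sup>2"
  shows "grad \<phi> (p + t *\<^sub>R d) \<bullet> d \<le> grad \<phi> p \<bullet> d + V * t * (norm d)\<^sup>2"
proof -
  obtain s where s: "0 < s" "s < t"
    and eq: "d \<bullet> grad \<phi> (p + t *\<^sub>R d) - d \<bullet> grad \<phi> (p + 0 *\<^sub>R d)
             = (t - 0) * (d \<bullet> (hessian \<phi> (p + s *\<^sub>R d) *v d))"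
    using MVT2[OF t, of "\<lambda>s. d \<bullet> grad \<phi> (p + s *\<^sub>R d)"
        "\<lambda>s. d \<bullet> (hessian \<phi> (p + s *\<^sub>R d) *v d)"] DERIV_slope_along_line[OF C2, of d p] by blast
  have "p + (s / t) *\<^sub>R (t *\<^sub>R d) \<in> S"
    using s by (intro line_in_convex[OF S]) auto
  then have "d \<bullet> (hessian \<phi> (p + s *\<^sub>R d) *v d) \<le> V * (norm d)\<^sup>2"
    using t by (intro hess) simp
  from mult_left_mono[OF this, of t] eq t show ?thesis
    by (simp add: inner_commute algebra_simps)
qed

section \<open>The search direction\<close>

lemma pos_def_symmetric: "pos_def M \<Longrightarrow> u \<bullet> (M *v w) = (M *v u) \<bullet> w"
  by (metis dot_lmul_matrix pos_def_def transpose_matrix_vector)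

lemma pos_def_nonneg: "pos_def M \<Longrightarrow> 0 \<le> z \<bullet> (M *v z)"
  by (cases "z = 0") (auto simp: pos_def_def less_imp_le)

lemma pos_def_mult_matrix_inv:
  fixes M :: "real^'n^'n"
  assumes "pos_def M"
  shows "M *v (matrix_inv M *v z) = z"
proof -
  have "z = 0" if "M *v z = 0" for z
    using assms that unfolding pos_def_def by (metis inner_zero_right less_irrefl)
  then have "invertible M"
    using matrix_left_invertible_ker[of M] invertible_left_inverse[of M] by blast
  then have "\<exists>A'. M ** A' = mat 1 \<and> A' ** M = mat 1"
    by (simp add: invertible_def)
  then have "M ** matrix_inv M = mat 1"
    unfolding matrix_inv_def by (rule someI2_ex) simp
  then show ?thesis
    by (simp add: matrix_vector_mul_assoc)
qed

lemma pos_def_matrix_inv_symmetric: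
  assumes "pos_def M"
  shows "u \<bullet> (matrix_inv M *v w) = (matrix_inv M *v u) \<bullet> w"
  using pos_def_symmetric[OF assms, of "matrix_inv M *v u" "matrix_inv M *v w"]
  by (simp add: pos_def_mult_matrix_inv[OF assms])

lemma pos_def_matrix_inv_nonneg:
  assumes "pos_def M"
  shows "0 \<le> z \<bullet> (matrix_inv M *v z)"
  using pos_def_nonneg[OF assms, of "matrix_inv M *v z"]
  by (simp add: pos_def_mult_matrix_inv[OF assms] inner_commute)

lemma first_order_optimality:
  fixes p r :: real
  assumes "\<And>\<tau>. 0 < \<tau> \<Longrightarrow> \<tau> \<le> 1 \<Longrightarrow> 0 \<le> 2 * \<tau> * p + \<tau>\<^sup>2 * r"
  shows "0 \<le> p"
proof (rule ccontr)
  assume "\<not> 0 \<le> p"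
  \<comment> \<open>So small that the linear term dominates the quadratic one.\<close>
  define \<tau> where "\<tau> = min 1 (- p / (\<bar>r\<bar> + 1))"
  have \<tau>: "0 < \<tau>" "\<tau> \<le> 1" "\<tau> \<le> - p / (\<bar>r\<bar> + 1)"
    using \<open>\<not> 0 \<le> p\<close> by (auto simp: \<tau>_def divide_neg_pos)
  have "\<tau> * r \<le> \<tau> * (\<bar>r\<bar> + 1)"
    using \<tau> by (intro mult_left_mono) auto
  also have "\<dots> \<le> - p"
    using \<tau>(3) by (subst (asm) pos_le_divide_eq) auto
  finally have "2 * p + \<tau> * r < 0"
    using \<open>\<not> 0 \<le> p\<close> by linarith
  then have "\<tau> * (2 * p + \<tau> * r) < 0"
    using \<tau>(1) by (rule mult_pos_neg[rotated])
  with assms[OF \<tau>(1,2)] show False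
    by (simp add: algebra_simps power2_eq_square)
qed

text \<open>
  Moving the multipliers from the minimizer towards the vertex of index \<open>i\<close> cannot decrease the
  dual objective. With \<open>g = - B d\<close> the combined gradient, the first-order form of this is
  \<open>g \<bullet> B\<^sup>-\<^sup>1 (g\<^sub>i - g) \<ge> 0\<close>, that is \<open>g\<^sub>i \<bullet> d \<le> - d \<bullet> B d\<close>.
\<close>

lemma maxdir_le_neg_quadratic_form:
  fixes f :: "'m::finite \<Rightarrow> real^'n \<Rightarrow> real" and l :: "real^'m"
  assumes B: "pos_def B"
    and l: "is_arg_min (\<lambda>l. 1/2 * (mat_norm (matrix_inv B) (comb_grad f l x))\<^sup>2)
              (\<lambda>l. l \<in> unit_simplex) l"
    and d: "d = - (matrix_inv B *v comb_grad f l x)"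
  shows "maxdir f x d \<le> - (d \<bullet> (B *v d))"
proof -
  define W where "W = matrix_inv B"
  define g where "g = comb_grad f l x"
  have l_simplex: "l \<in> unit_simplex"
    using l by (simp add: is_arg_min_def)
  have dual: "g \<bullet> (W *v g) \<le> comb_grad f l' x \<bullet> (W *v comb_grad f l' x)" if "l' \<in> unit_simplex" for l'
    using l that pos_def_matrix_inv_nonneg[OF B]
    by (auto simp: is_arg_min_def mat_norm_def not_less W_def g_def)
  have "d = - (W *v g)" "B *v d = - g"
    using d pos_def_mult_matrix_inv[OF B] by (simp_all add: W_def g_def vec.neg)
  then have quad: "d \<bullet> (B *v d) = g \<bullet> (W *v g)"
    by (simp add: inner_commute)
  have "grad (f i) x \<bullet> d \<le> - (d \<bullet> (B *v d))" for i
  proof -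
    define h where "h = grad (f i) x - g"
    have "0 \<le> 2 * \<tau> * (h \<bullet> (W *v g)) + \<tau>\<^sup>2 * (h \<bullet> (W *v h))" if \<tau>: "0 < \<tau>" "\<tau> \<le> 1" for \<tau>
    proof -
      define l' where "l' = (1 - \<tau>) *\<^sub>R l + \<tau> *\<^sub>R axis i 1"
      have "l' \<in> unit_simplex"
        using l_simplex \<tau>
        by (auto simp: l'_def unit_simplex_def axis_def sum.distrib simp flip: sum_distrib_left)
      moreover have "comb_grad f l' x = g + \<tau> *\<^sub>R h"
      proof -
        have "comb_grad f l' x
            = (\<Sum>j\<in>UNIV. (1 - \<tau>) *\<^sub>R (l $ j *\<^sub>R grad (f j) x)
                + \<tau> *\<^sub>R (if j = i then grad (f j) x else 0))"
          unfolding comb_grad_def by (intro sum.cong) (auto simp: l'_def axis_def algebra_simps)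
        also have "\<dots> = (1 - \<tau>) *\<^sub>R g + \<tau> *\<^sub>R grad (f i) x"
          by (simp add: sum.distrib g_def comb_grad_def scaleR_sum_right if_distrib[of "scaleR _"] cong: if_cong)
        finally show ?thesis
          by (simp add: h_def algebra_simps)
      qed
      ultimately have "g \<bullet> (W *v g) \<le> (g + \<tau> *\<^sub>R h) \<bullet> (W *v (g + \<tau> *\<^sub>R h))"
        using dual by metis
      moreover have "g \<bullet> (W *v h) = h \<bullet> (W *v g)"
        using pos_def_matrix_inv_symmetric[OF B] by (simp add: W_def inner_commute)
      ultimately show ?thesis
        by (simp add: algebra_simps power2_eq_square)
    qed
    then have "0 \<le> h \<bullet> (W *v g)"
      by (rule first_order_optimality)
    then show ?thesis
      unfolding quad using \<open>d = - (W *v g)\<close> by (simp add: h_def inner_diff_left)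
  qed
  then show ?thesis
    by (simp add: maxdir_def)
qed

text \<open>
  Sum the strong convexity inequalities with the weights \<open>l\<close>. The linear term becomes
  \<open>- d \<bullet> B (p - x)\<close>, and a weighted Young inequality for the form of \<open>B\<close> splits it into a multiple
  of \<open>d \<bullet> B d\<close> and a part that the quadratic term absorbs.
\<close>

lemma min_gap_le_direction:
  fixes f :: "'m::finite \<Rightarrow> real^'n \<Rightarrow> real" and l :: "real^'m"
  assumes convex: "\<And>i. f i x + (p - x) \<bullet> grad (f i) x + U / 2 * (norm (p - x))\<^sup>2 \<le> f i p"
    and l: "l \<in> unit_simplex"
    and B: "pos_def B" "\<And>z. z \<bullet> (B *v z) \<le> b * (norm z)\<^sup>2"
    and d: "comb_grad f l x = - (B *v d)"
    and Ub: "0 < U" "0 < b"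
  shows "(MIN i. f i x - f i p) \<le> b\<^sup>2 / (2 * U) * (norm d)\<^sup>2"
proof -
  define e where "e = p - x"
  \<comment> \<open>The Young parameter for which \<open>\<eta> / 2 * (e \<bullet> B e)\<close> is just absorbed by \<open>U / 2 * \<parallel>e\<parallel>\<^sup>2\<close>.\<close>
  define \<eta> where "\<eta> = U / b"
  have "0 < \<eta>" using Ub by (simp add: \<eta>_def)
  have l_nonneg: "0 \<le> l $ i" and l_sum: "(\<Sum>i\<in>UNIV. l $ i) = 1" for i
    using l by (auto simp: unit_simplex_def)
  have "(MIN i. f i x - f i p) = (\<Sum>i\<in>UNIV. l $ i * (MIN i. f i x - f i p))"
    using l_sum by (simp flip: sum_distrib_right)
  also have "\<dots> \<le> (\<Sum>i\<in>UNIV. l $ i * (- (e \<bullet> grad (f i) x) - U / 2 * (norm e)\<^sup>2))"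
  proof (intro sum_mono mult_left_mono l_nonneg)
    fix i
    have "(MIN i. f i x - f i p) \<le> f i x - f i p" by (intro Min_le) auto
    with convex[of i] show "(MIN i. f i x - f i p) \<le> - (e \<bullet> grad (f i) x) - U / 2 * (norm e)\<^sup>2"
      unfolding e_def by linarith
  qed
  also have "\<dots> = - (e \<bullet> comb_grad f l x) - U / 2 * (norm e)\<^sup>2 * (\<Sum>i\<in>UNIV. l $ i)"
    by (simp add: comb_grad_def inner_sum_right sum_subtractf sum_negf right_diff_distrib
        sum_distrib_left sum_distrib_right mult_ac)
  also have "\<dots> = e \<bullet> (B *v d) - U / 2 * (norm e)\<^sup>2"
    by (simp add: d l_sum)
  also have "\<dots> \<le> d \<bullet> (B *v d) / (2 * \<eta>)"
  proof -
    have "0 \<le> (d - \<eta> *\<^sub>R e) \<bullet> (B *v (d - \<eta> *\<^sub>R e))"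
      by (rule pos_def_nonneg[OF B(1)])
    also have "\<dots> = d \<bullet> (B *v d) - 2 * \<eta> * (e \<bullet> (B *v d)) + \<eta>\<^sup>2 * (e \<bullet> (B *v e))"
      using pos_def_symmetric[OF B(1), of d e]
      by (simp add: inner_commute algebra_simps power2_eq_square)
    also have "\<dots> \<le> d \<bullet> (B *v d) - 2 * \<eta> * (e \<bullet> (B *v d)) + \<eta>\<^sup>2 * (b * (norm e)\<^sup>2)"
      using B(2)[of e] by (intro add_left_mono mult_left_mono) auto
    also have "\<eta>\<^sup>2 * (b * (norm e)\<^sup>2) = 2 * \<eta> * (U / 2 * (norm e)\<^sup>2)"
      using Ub by (simp add: \<eta>_def power2_eq_square)
    finally have "(e \<bullet> (B *v d) - U / 2 * (norm e)\<^sup>2) * (2 * \<eta>) \<le> d \<bullet> (B *v d)"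
      by (simp add: algebra_simps)
    then show ?thesis
      using \<open>0 < \<eta>\<close> by (simp add: pos_le_divide_eq)
  qed
  also have "\<dots> \<le> b * (norm d)\<^sup>2 / (2 * \<eta>)"
    using B(2)[of d] \<open>0 < \<eta>\<close> by (intro divide_right_mono) auto
  also have "\<dots> = b\<^sup>2 / (2 * U) * (norm d)\<^sup>2"
    using Ub by (simp add: \<eta>_def power2_eq_square)
  finally show ?thesis .
qed

section \<open>Sequences controlled by a potential\<close>

text \<open>
  A Lojasiewicz-type estimate: a decrease of \<open>m\<close> of order \<open>\<sigma> \<delta>\<close> together with
  \<open>m = O(\<delta>\<^sup>2)\<close> bounds the step length \<open>\<sigma>\<close> by the decrease of \<open>sqrt m\<close>, whatever the size of
  \<open>\<delta>\<close>.
\<close>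

lemma step_le_sqrt_decrease:
  fixes A C \<sigma> \<delta> m m' :: real
  assumes A: "0 < A" and \<delta>: "0 < \<delta>" and m': "0 \<le> m'" "m' \<le> m"
    and decrease: "A * \<sigma> * \<delta> \<le> m - m'" and gap: "m \<le> C * \<delta>\<^sup>2"
  shows "\<sigma> \<le> 2 * sqrt C / A * (sqrt m - sqrt m')"
proof -
  have "sqrt m \<le> sqrt C * \<delta>"
    using real_sqrt_le_mono[OF gap] \<delta> by (simp add: real_sqrt_mult)
  have "A * \<sigma> * \<delta> \<le> (sqrt m + sqrt m') * (sqrt m - sqrt m')"
    using decrease m' by (simp add: algebra_simps)
  also have "\<dots> \<le> (2 * (sqrt C * \<delta>)) * (sqrt m - sqrt m')"
  proof (rule mult_right_mono)
    show "sqrt m + sqrt m' \<le> 2 * (sqrt C * \<delta>)"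
      using \<open>sqrt m \<le> sqrt C * \<delta>\<close> real_sqrt_le_mono[OF m'(2)] by linarith
  qed (use m' in simp)
  finally have "(A * \<sigma>) * \<delta> \<le> (2 * sqrt C * (sqrt m - sqrt m')) * \<delta>"
    by (simp add: mult_ac)
  then have "A * \<sigma> \<le> 2 * sqrt C * (sqrt m - sqrt m')"
    using \<delta> by (rule mult_right_le_imp_le)
  then show ?thesis
    using A by (simp add: pos_le_divide_eq mult_ac)
qed

text \<open>
  Near \<open>xs\<close> the total length of the remaining steps is at most \<open>\<kappa> * sqrt (m k)\<close>. Starting at an
  element of the subsequence at which both this bound and the distance to \<open>xs\<close> are below half the
  radius, the sequence never leaves the ball.
\<close>

lemma trapped_by_potential:
  fixes x :: "nat \<Rightarrow> real^'n"
  assumes lim: "limit_point_of xs x" and \<rho>: "0 < \<rho>" and \<kappa>: "0 \<le> \<kappa>"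
    and m_nonneg: "\<And>k. 0 \<le> m k" and m_lim: "m \<longlonglongrightarrow> 0"
    and step: "\<And>k. dist (x k) xs < \<rho> \<Longrightarrow>
      dist (x k) (x (Suc k)) \<le> \<kappa> * (sqrt (m k) - sqrt (m (Suc k)))"
  obtains N where "\<And>k. k \<ge> N \<Longrightarrow> dist (x k) xs < \<rho>"
    and "\<And>k. k \<ge> N \<Longrightarrow> dist (x k) xs \<le> \<kappa> * sqrt (m k)"
proof -
  obtain r where r: "strict_mono r" "(x \<circ> r) \<longlonglongrightarrow> xs"
    using lim by (auto simp: limit_point_of_def)
  have "(\<lambda>k. \<kappa> * sqrt (m k)) \<longlonglongrightarrow> \<kappa> * sqrt 0"
    by (intro tendsto_intros m_lim)
  then have "(\<lambda>j. \<kappa> * sqrt (m (r j))) \<longlonglongrightarrow> 0"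
    using LIMSEQ_subseq_LIMSEQ[OF _ r(1), of "\<lambda>k. \<kappa> * sqrt (m k)"] by (simp add: o_def)
  then have "\<forall>\<^sub>F j in sequentially. \<kappa> * sqrt (m (r j)) < \<rho> / 2"
    using \<rho> by (intro order_tendstoD(2)) auto
  moreover have "\<forall>\<^sub>F j in sequentially. dist ((x \<circ> r) j) xs < \<rho> / 2"
    using \<rho> by (intro tendstoD r) auto
  ultimately have "\<forall>\<^sub>F j in sequentially. \<kappa> * sqrt (m (r j)) < \<rho> / 2 \<and> dist ((x \<circ> r) j) xs < \<rho> / 2"
    by (rule eventually_conj)
  then obtain j0 where j0: "\<kappa> * sqrt (m (r j0)) < \<rho> / 2" "dist (x (r j0)) xs < \<rho> / 2"
    by (auto dest: eventually_happens)
  define N where "N = r j0"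
  have travel: "dist (x k) (x j) \<le> \<kappa> * (sqrt (m k) - sqrt (m j))"
    if "k \<le> j" and inside: "\<And>i. k \<le> i \<Longrightarrow> i < j \<Longrightarrow> dist (x i) xs < \<rho>" for k j
    using that
  proof (induction j rule: dec_induct)
    case base
    then show ?case by simp
  next
    case (step j)
    have "dist (x k) (x j) \<le> \<kappa> * (sqrt (m k) - sqrt (m j))"
      using step by auto
    moreover have "dist (x j) (x (Suc j)) \<le> \<kappa> * (sqrt (m j) - sqrt (m (Suc j)))"
      using step by (intro assms(6)) auto
    ultimately show ?case
      using dist_triangle[of "x k" "x (Suc j)" "x j"] by (simp add: algebra_simps)
  qed
  have trapped: "dist (x k) xs < \<rho>" if "k \<ge> N" for k
    using that
  proof (induction k rule: less_induct)
    case (less k)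
    have "dist (x N) (x k) \<le> \<kappa> * (sqrt (m N) - sqrt (m k))"
      using less by (intro travel) auto
    also have "\<dots> \<le> \<kappa> * sqrt (m N)"
      using \<kappa> m_nonneg by (intro mult_left_mono) auto
    finally show ?case
      using j0 dist_triangle[of "x k" xs "x N"] by (simp add: N_def dist_commute)
  qed
  show ?thesis
  proof (rule that[of N])
    fix k assume k: "k \<ge> N"
    show "dist (x k) xs \<le> \<kappa> * sqrt (m k)"
    proof (rule tendsto_upperbound[OF tendsto_dist[OF tendsto_const r(2)]])
      have "dist (x k) ((x \<circ> r) j) \<le> \<kappa> * sqrt (m k)" if "j \<ge> k" for j
      proof -
        have "dist (x k) (x (r j)) \<le> \<kappa> * (sqrt (m k) - sqrt (m (r j)))"
          using that seq_suble[OF r(1), of j] k trapped by (intro travel) auto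
        also have "\<dots> \<le> \<kappa> * sqrt (m k)"
          using \<kappa> m_nonneg by (intro mult_left_mono) auto
        finally show ?thesis by simp
      qed
      then show "\<forall>\<^sub>F j in sequentially. dist (x k) ((x \<circ> r) j) \<le> \<kappa> * sqrt (m k)"
        unfolding eventually_sequentially by blast
    qed simp
  qed (rule trapped)
qed

text \<open>
  The finitely many indices below \<open>N\<close> are absorbed into the constant, and replacing \<open>q\<close> by a larger
  rate makes it positive.
\<close>

lemma R_linear_of_contracting_potential:
  assumes bound: "\<And>k. k \<ge> N \<Longrightarrow> dist (x k) xs \<le> \<kappa> * sqrt (m k)" and \<kappa>: "0 \<le> \<kappa>"
    and m_nonneg: "\<And>k. 0 \<le> m k"
    and contract: "\<And>k. k \<ge> N \<Longrightarrow> m (Suc k) \<le> q * m k" and q: "q < 1"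
  shows "R_linearly_converges x xs"
proof -
  define \<theta> where "\<theta> = sqrt (max q (1/2))"
  have \<theta>: "0 < \<theta>" "\<theta> < 1" "q \<le> \<theta>\<^sup>2"
    using q by (auto simp: \<theta>_def)
  have decay: "m k \<le> m N * (\<theta>\<^sup>2) ^ (k - N)" if "k \<ge> N" for k
    using that
  proof (induction k rule: dec_induct)
    case (step k)
    have "m (Suc k) \<le> \<theta>\<^sup>2 * m k"
      using contract[of k] mult_right_mono[OF \<theta>(3) m_nonneg[of k]] step by linarith
    also have "\<dots> \<le> \<theta>\<^sup>2 * (m N * (\<theta>\<^sup>2) ^ (k - N))"
      using step by (intro mult_left_mono) auto
    finally show ?case
      using step by (simp add: Suc_diff_le mult_ac)
  qed simp
  define K where "K = \<kappa> * sqrt (m N) / \<theta> ^ N + (\<Sum>k<N. dist (x k) xs / \<theta> ^ k)"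
  have tail_nonneg: "0 \<le> \<kappa> * sqrt (m N) / \<theta> ^ N"
    using \<kappa> m_nonneg \<theta> by auto
  have head_nonneg: "0 \<le> (\<Sum>k<N. dist (x k) xs / \<theta> ^ k)"
    using \<theta> by (intro sum_nonneg) auto
  have "dist (x k) xs \<le> K * \<theta> ^ k" for k
  proof (cases "k \<ge> N")
    case True
    have "dist (x k) xs \<le> \<kappa> * sqrt (m N * (\<theta>\<^sup>2) ^ (k - N))"
      using bound[OF True] decay[OF True] \<kappa> by (meson mult_left_mono order_trans real_sqrt_le_mono)
    also have "\<dots> = \<kappa> * sqrt (m N) * \<theta> ^ (k - N)"
      using \<theta> by (simp add: real_sqrt_mult real_sqrt_power)
    also have "\<dots> = (\<kappa> * sqrt (m N) / \<theta> ^ N) * \<theta> ^ k"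
      using \<theta> True by (simp add: power_diff)
    also have "\<dots> \<le> K * \<theta> ^ k"
      using head_nonneg \<theta> by (intro mult_right_mono) (auto simp: K_def)
    finally show ?thesis .
  next
    case False
    have "dist (x k) xs / \<theta> ^ k \<le> (\<Sum>k<N. dist (x k) xs / \<theta> ^ k)"
      using False \<theta> by (intro member_le_sum) auto
    also have "\<dots> \<le> K"
      using tail_nonneg by (simp add: K_def)
    finally show ?thesis
      using \<theta> by (simp add: pos_divide_le_eq)
  qed
  moreover have "0 \<le> K"
    using tail_nonneg head_nonneg by (simp add: K_def)
  ultimately show ?thesis
    unfolding R_linearly_converges_def using \<theta> by (auto simp: dist_norm)
qed

section \<open>R-linear convergence of BB-DQN\<close>

theorem theorem4p4:
  fixes f :: "'m::finite \<Rightarrow> real^'n \<Rightarrow> real"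
    and x0 xs :: "real^'n"
    and B0 :: "real^'n^'n"
    and \<alpha>init :: "real^'n"
    and x :: "nat \<Rightarrow> real^'n"
    and B :: "nat \<Rightarrow> real^'n^'n"
    and c0 c1 c2 \<mu> \<sigma>1 \<sigma>2 \<epsilon> a b U V :: real
  assumes f_C2: "\<And>i. twice_continuously_differentiable (f i)"
    and c0: "0 < c0" "c0 \<le> 1"
    and c1: "0 < c1" and c2: "0 < c2" and \<mu>: "0 < \<mu>"
    and \<sigma>: "0 < \<sigma>1" "\<sigma>1 < \<sigma>2" "\<sigma>2 < 1"
    and \<epsilon>: "0 \<le> \<epsilon>"
    and B0: "pos_def B0"
    and \<alpha>init: "\<And>j. 0 < \<alpha>init $ j"
    and run: "bb_dqn_run f c0 c1 c2 \<mu> \<sigma>1 \<sigma>2 \<epsilon> x0 B0 \<alpha>init x B"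
    and lim: "limit_point_of xs x"
    and ab: "0 < a" "a \<le> b"
    and B_bounds: "\<And>k. a *\<^sub>R mat 1 \<preceq> B k \<and> B k \<preceq> b *\<^sub>R mat 1"
    and UV: "0 < U" "U \<le> 1" "1 \<le> V"
    and hess_bounds: "\<And>z i p. p \<in> level_set f x0 \<Longrightarrow>
        U * (norm z)\<^sup>2 \<le> z \<bullet> (hessian (f i) p *v z) \<and>
        z \<bullet> (hessian (f i) p *v z) \<le> V * (norm z)\<^sup>2"
  shows "R_linearly_converges x xs"
proof -
  obtain lam :: "nat \<Rightarrow> real^'m" and d :: "nat \<Rightarrow> real^'n" and t :: "nat \<Rightarrow> real"
    where x_0: "x 0 = x0"
      and lam: "\<And>k. is_arg_min (\<lambda>l. 1/2 * (mat_norm (matrix_inv (B k)) (comb_grad f l (x k)))\<^sup>2)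
                   (\<lambda>l. l \<in> unit_simplex) (lam k)"
      and d: "\<And>k. d k = - (matrix_inv (B k) *v comb_grad f (lam k) (x k))"
      and d_nz: "\<And>k. d k \<noteq> 0"
      and t: "\<And>k. 0 < t k"
      and armijo: "\<And>k i. f i (x k + t k *\<^sub>R d k) \<le> f i (x k) + \<sigma>1 * t k * maxdir f (x k) (d k)"
      and curvature: "\<And>k. maxdir f (x k + t k *\<^sub>R d k) (d k) \<ge> \<sigma>2 * maxdir f (x k) (d k)"
      and x_Suc: "\<And>k. x (Suc k) = x k + t k *\<^sub>R d k"
    using run unfolding bb_dqn_run_def by blast
  have b: "0 < b" using ab by linarith
  have B_form: "a * (norm z)\<^sup>2 \<le> z \<bullet> (B k *v z)" "z \<bullet> (B k *v z) \<le> b * (norm z)\<^sup>2" for k z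
    using B_bounds[of k] unfolding loewner_le_def pos_semidef_def
    by (simp_all add: matrix_vector_mult_diff_rdistrib inner_diff_right scaleR_matrix_vector_assoc[symmetric]
        dot_square_norm)
  have B_pos_def: "pos_def (B k)" for k
  proof -
    have "transpose (B k - a *\<^sub>R mat 1) = B k - a *\<^sub>R mat 1"
      using B_bounds[of k] by (simp add: loewner_le_def pos_semidef_def)
    then have entries: "(transpose (B k - a *\<^sub>R mat 1)) $ i $ j = (B k - a *\<^sub>R mat 1) $ i $ j" for i j
      by simp
    have "B k $ j $ i = B k $ i $ j" for i j
      using entries[of i j] by (cases "i = j") (simp_all add: transpose_def mat_def)
    then have "transpose (B k) = B k"
      by (simp add: transpose_def vec_eq_iff)
    moreover have "0 < z \<bullet> (B k *v z)" if "z \<noteq> 0" for z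
    proof -
      have "0 < a * (norm z)\<^sup>2" using ab that by simp
      with B_form(1)[of z k] show ?thesis by linarith
    qed
    ultimately show ?thesis by (simp add: pos_def_def)
  qed
  have maxdir_le: "maxdir f (x k) (d k) \<le> - (a * (norm (d k))\<^sup>2)" for k
    using maxdir_le_neg_quadratic_form[OF B_pos_def lam d, of k] B_form(1)[of "d k" k] by linarith

  have decrease: "f i (x (Suc k)) + \<sigma>1 * a * t k * (norm (d k))\<^sup>2 \<le> f i (x k)" for i k
  proof -
    have "\<sigma>1 * t k * maxdir f (x k) (d k) \<le> \<sigma>1 * t k * (- (a * (norm (d k))\<^sup>2))"
      using \<sigma> t[of k] maxdir_le by (intro mult_left_mono) auto
    with armijo[of i k] show ?thesis
      by (simp add: x_Suc algebra_simps)
  qed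
  have strict_decrease: "f i (x (Suc k)) < f i (x k)" for i k
  proof -
    have "0 < \<sigma>1 * a * t k * (norm (d k))\<^sup>2"
      using \<sigma> ab t[of k] d_nz[of k] by simp
    with decrease[of i k] show ?thesis by linarith
  qed
  have f_decseq: "decseq (\<lambda>k. f i (x k))" for i
    using strict_decrease by (intro decseq_SucI less_imp_le)
  have f_cont: "isCont (f i) p" for i p
    using f_C2[of i] by (simp add: twice_continuously_differentiable_def differentiable_imp_continuous_within)
  obtain r where r: "strict_mono r" "(x \<circ> r) \<longlonglongrightarrow> xs"
    using lim by (auto simp: limit_point_of_def)
  have f_sub_lim: "(\<lambda>j. f i (x (r j))) \<longlonglongrightarrow> f i xs" for i
    using isCont_tendsto_compose[OF f_cont r(2)] by (simp add: o_def)
  have f_ge: "f i xs \<le> f i (x k)" for i k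
  proof (rule tendsto_upperbound[OF f_sub_lim])
    show "\<forall>\<^sub>F j in sequentially. f i (x (r j)) \<le> f i (x k)"
      unfolding eventually_sequentially
      using decseqD[OF f_decseq] seq_suble[OF r(1)] by (meson order_trans)
  qed simp
  have f_lim: "(\<lambda>k. f i (x k)) \<longlonglongrightarrow> f i xs" for i
  proof -
    obtain L where L: "(\<lambda>k. f i (x k)) \<longlonglongrightarrow> L"
      using decseq_convergent[OF f_decseq, of "f i xs" i] f_ge by metis
    from LIMSEQ_subseq_LIMSEQ[OF this r(1)] have "L = f i xs"
      using f_sub_lim[of i] by (intro LIMSEQ_unique) (auto simp: o_def)
    with L show ?thesis by simp
  qed

  \<comment> \<open>Strict decrease puts \<open>xs\<close> in the interior of the level set.\<close>
  obtain \<rho> where \<rho>: "0 < \<rho>" and ball: "ball xs \<rho> \<subseteq> level_set f x0"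
  proof -
    have "\<forall>\<^sub>F p in nhds xs. f i p < f i x0" for i
    proof (rule order_tendstoD(2))
      show "(f i \<longlongrightarrow> f i xs) (nhds xs)"
        using f_cont[of xs i] by (simp add: isCont_def tendsto_at_iff_tendsto_nhds)
      show "f i xs < f i x0"
        using f_ge[of i "Suc 0"] strict_decrease[of i 0] by (simp add: x_0)
    qed
    then have "\<forall>\<^sub>F p in nhds xs. \<forall>i. f i p < f i x0"
      by (simp add: eventually_all_finite)
    then obtain \<rho> where "0 < \<rho>" "\<And>p. dist p xs < \<rho> \<Longrightarrow> \<forall>i. f i p < f i x0"
      unfolding eventually_nhds_metric by blast
    then show ?thesis
      by (intro that[of \<rho>]) (auto simp: level_set_def dist_commute less_imp_le)
  qed

  have hess_lower: "U * (norm z)\<^sup>2 \<le> z \<bullet> (hessian (f i) p *v z)"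
    and hess_upper: "z \<bullet> (hessian (f i) p *v z) \<le> V * (norm z)\<^sup>2"
    if "p \<in> ball xs \<rho>" for p z i
    using hess_bounds[OF subsetD[OF ball that], of z i] by auto

  define m where "m k = (MIN i. f i (x k) - f i xs)" for k
  have m_attained: "\<exists>i. m k = f i (x k) - f i xs" for k
  proof -
    have "m k \<in> range (\<lambda>i. f i (x k) - f i xs)"
      unfolding m_def by (intro Min_in) auto
    then show ?thesis by blast
  qed
  have m_le: "m k \<le> f i (x k) - f i xs" for k i
    unfolding m_def by (intro Min_le) auto
  have m_nonneg: "0 \<le> m k" for k
    using m_attained[of k] f_ge by (metis diff_ge_0_iff_ge)
  have m_lim: "m \<longlonglongrightarrow> 0"
  proof (rule tendsto_sandwich[OF _ _ tendsto_const])
    show "(\<lambda>k. f undefined (x k) - f undefined xs) \<longlonglongrightarrow> 0"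
      using tendsto_diff[OF f_lim tendsto_const, of undefined "f undefined xs"] by simp
  qed (use m_le m_nonneg in auto)
  have m_decrease: "m (Suc k) + \<sigma>1 * a * t k * (norm (d k))\<^sup>2 \<le> m k" for k
  proof -
    \<comment> \<open>An index that attains the minimum at \<open>k\<close> also bounds the minimum at \<open>Suc k\<close> from above.\<close>
    obtain i where "m k = f i (x k) - f i xs" using m_attained by blast
    with decrease[of i k] m_le[of "Suc k" i] show ?thesis by linarith
  qed

  define C where "C = b\<^sup>2 / (2 * U)"
  have C: "0 < C" using b UV by (simp add: C_def)
  have gap: "m k \<le> C * (norm (d k))\<^sup>2" if k: "dist (x k) xs < \<rho>" for k
    unfolding m_def C_def
  proof (rule min_gap_le_direction[OF _ _ B_pos_def B_form(2) _ UV(1) b])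
    show "f i (x k) + (xs - x k) \<bullet> grad (f i) (x k) + U / 2 * (norm (xs - x k))\<^sup>2 \<le> f i xs" for i
      using k \<rho> by (intro strongly_convex_lower_bound[OF f_C2 convex_ball _ _ hess_lower])
        (auto simp: dist_commute)
    show "lam k \<in> unit_simplex"
      using lam[of k] by (simp add: is_arg_min_def)
    show "comb_grad f (lam k) (x k) = - (B k *v d k)"
      by (simp add: d vec.neg pos_def_mult_matrix_inv[OF B_pos_def])
  qed

  define \<kappa> where "\<kappa> = 2 * sqrt C / (\<sigma>1 * a)"
  have \<kappa>: "0 \<le> \<kappa>" using C \<sigma> ab by (simp add: \<kappa>_def)
  have step: "dist (x k) (x (Suc k)) \<le> \<kappa> * (sqrt (m k) - sqrt (m (Suc k)))"
    if "dist (x k) xs < \<rho>" for k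
    unfolding \<kappa>_def
  proof (rule step_le_sqrt_decrease)
    have s: "dist (x k) (x (Suc k)) = t k * norm (d k)"
      using t[of k] by (simp add: x_Suc dist_norm)
    show dec: "\<sigma>1 * a * dist (x k) (x (Suc k)) * norm (d k) \<le> m k - m (Suc k)"
      using m_decrease[of k] unfolding s by (simp add: power2_eq_square mult_ac)
    have "0 \<le> \<sigma>1 * a * dist (x k) (x (Suc k)) * norm (d k)"
      using \<sigma> ab by simp
    with dec show "m (Suc k) \<le> m k"
      by linarith
  qed (use \<sigma> ab d_nz m_nonneg gap[OF that] in auto)
  obtain N where inside: "\<And>k. k \<ge> N \<Longrightarrow> dist (x k) xs < \<rho>"
    and dist_le: "\<And>k. k \<ge> N \<Longrightarrow> dist (x k) xs \<le> \<kappa> * sqrt (m k)"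
    using trapped_by_potential[where m = m, OF lim \<rho> \<kappa> m_nonneg m_lim step] by blast

  \<comment> \<open>The slope along \<open>d k\<close> starts below \<open>- a * \<parallel>d k\<parallel>\<^sup>2\<close>, must lose the fraction \<open>1 - \<sigma>2\<close> of its
    size, and grows at rate at most \<open>V * \<parallel>d k\<parallel>\<^sup>2\<close>.\<close>
  define \<tau> where "\<tau> = (1 - \<sigma>2) * a / V"
  have \<tau>: "0 < \<tau>" using \<sigma> ab UV by (simp add: \<tau>_def)
  have t_ge: "\<tau> \<le> t k" if k: "k \<ge> N" for k
  proof -
    have in_ball: "x k \<in> ball xs \<rho>" "x k + t k *\<^sub>R d k \<in> ball xs \<rho>"
      using inside[of k] inside[of "Suc k"] k by (auto simp: dist_commute x_Suc)
    have "grad (f i) (x k + t k *\<^sub>R d k) \<bullet> d k \<le> maxdir f (x k) (d k) + V * t k * (norm (d k))\<^sup>2" for i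
    proof -
      have "grad (f i) (x k + t k *\<^sub>R d k) \<bullet> d k
          \<le> grad (f i) (x k) \<bullet> d k + V * t k * (norm (d k))\<^sup>2"
        by (rule slope_upper_bound[OF f_C2 convex_ball in_ball t hess_upper])
      moreover have "grad (f i) (x k) \<bullet> d k \<le> maxdir f (x k) (d k)"
        unfolding maxdir_def by (intro Max_ge) auto
      ultimately show ?thesis by linarith
    qed
    then have "maxdir f (x k + t k *\<^sub>R d k) (d k) \<le> maxdir f (x k) (d k) + V * t k * (norm (d k))\<^sup>2"
      by (subst maxdir_def) simp
    with curvature[of k]
    have "(1 - \<sigma>2) * - maxdir f (x k) (d k) \<le> V * t k * (norm (d k))\<^sup>2"
      by (simp add: algebra_simps)
    moreover have "(1 - \<sigma>2) * (a * (norm (d k))\<^sup>2) \<le> (1 - \<sigma>2) * - maxdir f (x k) (d k)"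
      using maxdir_le[of k] \<sigma> by (intro mult_left_mono) auto
    ultimately have "((1 - \<sigma>2) * a) * (norm (d k))\<^sup>2 \<le> (V * t k) * (norm (d k))\<^sup>2"
      by (simp add: mult_ac)
    then have "(1 - \<sigma>2) * a \<le> V * t k"
      using d_nz[of k] by simp
    then show ?thesis
      using UV by (simp add: \<tau>_def pos_divide_le_eq mult.commute)
  qed
  have contract: "m (Suc k) \<le> (1 - \<sigma>1 * a * \<tau> / C) * m k" if k: "k \<ge> N" for k
  proof -
    have "\<sigma>1 * a * \<tau> / C * m k \<le> \<sigma>1 * a * \<tau> / C * (C * (norm (d k))\<^sup>2)"
      using gap[OF inside[OF k]] \<sigma> ab \<tau> C by (intro mult_left_mono) auto
    also have "\<dots> = \<sigma>1 * a * \<tau> * (norm (d k))\<^sup>2"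
      using C by simp
    also have "\<dots> \<le> \<sigma>1 * a * t k * (norm (d k))\<^sup>2"
      using t_ge[OF k] \<sigma> ab by (intro mult_right_mono mult_left_mono) auto
    finally show ?thesis
      using m_decrease[of k] by (simp add: algebra_simps)
  qed
  show ?thesis
  proof (rule R_linear_of_contracting_potential[where m = m])
    show "1 - \<sigma>1 * a * \<tau> / C < 1"
      using \<sigma> ab \<tau> C by simp
  qed (fact dist_le \<kappa> m_nonneg contract)+
qed

end
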